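(* Let $R$ be an associative ring with unit $1_R$ such that $\frac{1}{2}\in R$ (i.e. $2\cdot 1_R$ is invertible in $R$), and let $I$ be an infinite set. (a) For every derivation $d$ of the Lie ring $\mathfrak{sl}_{\infty}(I,R)$ there exist $a\in \mathfrak{gl}_{rcf}(I,R)$ and $u\in \mathrm{Der}(R)$ such that $d=\mathrm{ad}(a)+u$ on $\mathfrak{sl}_{\infty}(I,R)$. (b) For every derivation $d$ of the Lie ring $\mathfrak{gl}(I,R)$ (respectively, of the Lie ring $\mathfrak{gl}_{rcf}(I,R)$) there exist $a\in\mathfrak{gl}(I,R)$ (respectively, $a\in \mathfrak{gl}_{rcf}(I,R)$) and $u\in \mathrm{Der}(R)$ such that $d=\mathrm{ad}(a)+u$ on $\mathfrak{gl}(I,R)$ (respectively, on $\mathfrak{gl}_{rcf}(I,R)$). Here $u\in\mathrm{Der}(R)$ acts on matrices entrywise.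
   Context: For an associative (not necessarily commutative) ring $R$ with unit and an infinite set $I$: - $M(I,R)$ is the ring of $(I\times I)$-matrices over $R$ having finitely many nonzero entries in each column. - $M_{rcf}(I,R)\subseteq M(I,R)$ is the subring of all $(I\times I)$-matrices over $R$ having finitely many nonzero entries in each row and in each column. - $M_{\infty}(I,R)\subseteq M(I,R)$ is the subring of all $(I\times I)$-matrices over $R$ having only finitely many nonzero entries. It is a two-sided ideal of $M_{rcf}(I,R)$. An associative ring $A$ gives the Lie ring $A^{(-)}=(A,\ [a,b]=ab-ba)$. Put $\mathfrak{gl}(I,R)=M(I,R)^{(-)}$, $\mathfrak{gl}_{rcf}(I,R)=M_{rcf}(I,R)^{(-)}$, $\mathfrak{gl}_{\infty}(I,R)=M_{\infty}(I,R)^{(-)}$, and $\mathfrak{sl}_{\infty}(I,R)=[\mathfrak{gl}_{\infty}(I,R),\mathfrak{gl}_{\infty}(I,R)]$, the additive subgroup generated by all commutators $[x,y]$ with $x,y\in \mathfrak{gl}_{\infty}(I,R)$. A derivation of a Lie ring $L$ is an additive map $d:L\to L$ with $d([x,y])=[d(x),y]+[x,d(y)]$ for all $x,y\in L$. $\mathrm{Der}(R)$ denotes the set of derivations of the associative ring $R$, i.e. additive maps $u:R\to R$ with $u(xy)=u(x)y+x\,u(y)$. Derivations are only assumed additive. For $a\in M(I,R)$, $\mathrm{ad}(a)$ is the map $x\mapsto [a,x]=ax-xa$; for $a\in M_{rcf}(I,R)$ it maps $\mathfrak{sl}_{\infty}(I,R)$ into itself. A derivation $u\in\mathrm{Der}(R)$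 is identified with the map on matrices applying $u$ to every entry, $(a_{ij})\mapsto(u(a_{ij}))$; it leaves $\mathfrak{gl}_{rcf}(I,R)$ and $\mathfrak{sl}_{\infty}(I,R)$ invariant. *)

theory Defs
  imports "HOL-Library.Function_Algebras" "HOL-Computational_Algebra.Group_Closure"
begin

text \<open>
  The ring of scalars is a type of sort \<open>{ring, monoid_mult}\<close>: associative, with unit, not
  necessarily commutative. In contrast to \<open>ring_1\<close>, this sort admits the zero ring. The index set is
  a type. Addition, subtraction and zero of matrices are the pointwise operations on functions;
  the pointwise product \<open>*\<close> on functions is not the matrix product and is not used.
\<close>

type_synonym ('i, 'r) matrix = "'i \<Rightarrow> 'i \<Rightarrow> 'r"

definition M :: "('i, 'r::zero) matrix set" where
  "M = {a. \<forall>j. finite {i. a i j \<noteq> 0}}"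

definition M_rcf :: "('i, 'r::zero) matrix set" where
  "M_rcf = {a \<in> M. \<forall>i. finite {j. a i j \<noteq> 0}}"

definition M_inf :: "('i, 'r::zero) matrix set" where
  "M_inf = {a. finite {(i, j). a i j \<noteq> 0}}"

text \<open>The index set of the sum is finite whenever \<open>b\<close> has finite columns.\<close>

definition mat_mult :: "('i, 'r::ring) matrix \<Rightarrow> ('i, 'r) matrix \<Rightarrow> ('i, 'r) matrix"
    (infixl \<open>\<star>\<close> 70) where
  "a \<star> b = (\<lambda>i j. \<Sum>k | b k j \<noteq> 0. a i k * b k j)"

definition bracket :: "('i, 'r::ring) matrix \<Rightarrow> ('i, 'r) matrix \<Rightarrow> ('i, 'r) matrix" where
  "bracket a b = a \<star> b - b \<star> a"

text \<open>
  A Lie ring of matrices is represented by its underlying set, the operations being addition and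
  \<^const>\<open>bracket\<close>; so the Lie ring of an associative ring of matrices has the same underlying set.
\<close>

abbreviation gl :: "('i, 'r::ring) matrix set" where
  "gl \<equiv> M"

abbreviation gl_rcf :: "('i, 'r::ring) matrix set" where
  "gl_rcf \<equiv> M_rcf"

abbreviation gl_inf :: "('i, 'r::ring) matrix set" where
  "gl_inf \<equiv> M_inf"

definition sl_inf :: "('i, 'r::ring) matrix set" where
  "sl_inf = group_closure {bracket x y | x y. x \<in> gl_inf \<and> y \<in> gl_inf}"

text \<open>
  A derivation of the Lie ring \<open>L\<close> is a map from \<open>L\<close> to \<open>L\<close>; its values outside \<open>L\<close> are irrelevant.
\<close>

definition lie_derivation ::
    "('i, 'r::ring) matrix set \<Rightarrow> (('i, 'r) matrix \<Rightarrow> ('i, 'r) matrix) \<Rightarrow> bool" where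
  "lie_derivation L d \<longleftrightarrow>
     (\<forall>x\<in>L. d x \<in> L) \<and>
     (\<forall>x\<in>L. \<forall>y\<in>L. d (x + y) = d x + d y) \<and>
     (\<forall>x\<in>L. \<forall>y\<in>L. d (bracket x y) = bracket (d x) y + bracket x (d y))"

definition Der :: "('r::ring \<Rightarrow> 'r) set" where
  "Der = {u. (\<forall>x y. u (x + y) = u x + u y) \<and> (\<forall>x y. u (x * y) = u x * y + x * u y)}"

definition ad :: "('i, 'r::ring) matrix \<Rightarrow> ('i, 'r) matrix \<Rightarrow> ('i, 'r) matrix" where
  "ad a x = bracket a x"

definition entrywise :: "('r \<Rightarrow> 'r) \<Rightarrow> ('i, 'r) matrix \<Rightarrow> ('i, 'r) matrix" where
  "entrywise u x = (\<lambda>i j. u (x i j))"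

end

theory Submission imports Defs begin

text \<open>
  Write \<open>e\<^bsub>ij\<^esub>\<close> for the matrix units. A derivation \<open>d\<close> on the finitary matrices takes the
  commuting elements \<open>e\<^bsub>ss\<^esub> - e\<^bsub>tt\<^esub>\<close> to matrices whose off-diagonal parts agree with those of
  \<open>ad a\<close> for one matrix \<open>a\<close>. After subtracting \<open>ad a\<close>, comparison of weights shows that \<open>d\<close> maps
  each \<open>r e\<^bsub>ij\<^esub>\<close>, \<open>i \<noteq> j\<close>, to \<open>c\<^bsub>ij\<^esub>(r) e\<^bsub>ij\<^esub>\<close>. The relation
  \<open>c\<^bsub>ij\<^esub>(rs) = c\<^bsub>ik\<^esub>(r) s + r c\<^bsub>kj\<^esub>(s)\<close> yields a diagonal matrix after whose subtraction all
  \<open>c\<^bsub>ij\<^esub>\<close> are one derivation \<open>u\<close> of the ring.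

  For the infinite matrices it remains to treat a derivation that vanishes on the finitary ones.
  For every column-finite \<open>x\<close> and distinct \<open>i\<close>, \<open>j\<close>, \<open>l\<close>, the double bracket
  \<open>[[x, r e\<^bsub>ij\<^esub>], e\<^bsub>jl\<^esub>]\<close> is finitary of trace zero, although \<open>[x, r e\<^bsub>ij\<^esub>]\<close> need not be finitary;
  hence all values of the derivation are central scalars, so it kills commutators, and every
  matrix is a sum of commutators.
\<close>

section \<open>Column-finite matrices\<close>

lemma M_iff: "a \<in> M \<longleftrightarrow> (\<forall>j. finite {i. a i j \<noteq> 0})"
  by (simp add: M_def)

lemma M_rcf_iff: "a \<in> M_rcf \<longleftrightarrow> a \<in> M \<and> (\<forall>i. finite {j. a i j \<noteq> 0})"
  by (simp add: M_rcf_def)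

lemma M_add: "a \<in> M \<Longrightarrow> b \<in> M \<Longrightarrow> a + b \<in> M" for a :: "('i, 'r::ring) matrix"
  unfolding M_iff
  by (intro allI, rule_tac B = "{i. a i j \<noteq> 0} \<union> {i. b i j \<noteq> 0}" in finite_subset) auto

lemma M_diff: "a \<in> M \<Longrightarrow> b \<in> M \<Longrightarrow> a - b \<in> M" for a :: "('i, 'r::ring) matrix"
  unfolding M_iff
  by (intro allI, rule_tac B = "{i. a i j \<noteq> 0} \<union> {i. b i j \<noteq> 0}" in finite_subset) auto

lemma M_rcf_add: "a \<in> M_rcf \<Longrightarrow> b \<in> M_rcf \<Longrightarrow> a + b \<in> M_rcf" for a :: "('i, 'r::ring) matrix"
  unfolding M_rcf_iff
  by (intro conjI allI, simp add: M_add,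
      rule_tac B = "{j. a i j \<noteq> 0} \<union> {j. b i j \<noteq> 0}" in finite_subset) auto

lemma M_rcf_diff: "a \<in> M_rcf \<Longrightarrow> b \<in> M_rcf \<Longrightarrow> a - b \<in> M_rcf" for a :: "('i, 'r::ring) matrix"
  unfolding M_rcf_iff
  by (intro conjI allI, simp add: M_diff,
      rule_tac B = "{j. a i j \<noteq> 0} \<union> {j. b i j \<noteq> 0}" in finite_subset) auto

lemma M_zero [simp]: "0 \<in> M" "0 \<in> M_rcf"
  by (simp_all add: M_iff M_rcf_iff)

text \<open>The index set in the definition of \<open>\<star>\<close> varies with the right factor
  and the column; passing to a common finite superset makes sums for different factors
  comparable.\<close>

lemma mat_mult_eq_sum:
  assumes "finite F" "{k. b k j \<noteq> 0} \<subseteq> F"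
  shows "(a \<star> b) i j = (\<Sum>k\<in>F. a i k * b k j)"
  unfolding mat_mult_def using assms by (intro sum.mono_neutral_left) auto

lemma mat_mult_eq_single:
  assumes "finite {k. b k j \<noteq> 0}" "\<And>k. k \<noteq> l \<Longrightarrow> a i k * b k j = 0"
  shows "(a \<star> b) i j = a i l * b l j"
proof -
  have "(a \<star> b) i j = (\<Sum>k\<in>insert l {k. b k j \<noteq> 0}. a i k * b k j)"
    by (rule mat_mult_eq_sum) (use assms in auto)
  also have "\<dots> = (\<Sum>k\<in>{l}. a i k * b k j)"
    by (rule sum.mono_neutral_right) (use assms in auto)
  finally show ?thesis by simp
qed

lemma M_mult:
  assumes "a \<in> M" "b \<in> M"
  shows "a \<star> b \<in> M"
  unfolding M_iff
proof
  fix j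
  have "{i. (a \<star> b) i j \<noteq> 0} \<subseteq> (\<Union>k\<in>{k. b k j \<noteq> 0}. {i. a i k \<noteq> 0})"
    unfolding mat_mult_def by (force elim: sum.not_neutral_contains_not_neutral)
  moreover have "finite (\<Union>k\<in>{k. b k j \<noteq> 0}. {i. a i k \<noteq> 0})"
    using assms by (simp add: M_iff)
  ultimately show "finite {i. (a \<star> b) i j \<noteq> 0}"
    by (rule finite_subset)
qed

lemma M_rcf_mult:
  assumes "a \<in> M_rcf" "b \<in> M_rcf"
  shows "a \<star> b \<in> M_rcf"
  unfolding M_rcf_iff
proof (intro conjI allI)
  show "a \<star> b \<in> M" using assms by (simp add: M_rcf_iff M_mult)
next
  fix i
  have "{j. (a \<star> b) i j \<noteq> 0} \<subseteq> (\<Union>k\<in>{k. a i k \<noteq> 0}. {j. b k j \<noteq> 0})"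
    unfolding mat_mult_def by (force elim: sum.not_neutral_contains_not_neutral)
  moreover have "finite (\<Union>k\<in>{k. a i k \<noteq> 0}. {j. b k j \<noteq> 0})"
    using assms by (simp add: M_rcf_iff)
  ultimately show "finite {j. (a \<star> b) i j \<noteq> 0}"
    by (rule finite_subset)
qed

lemma mat_mult_add_left: "(a + b) \<star> c = a \<star> c + b \<star> c"
  by (simp add: fun_eq_iff mat_mult_def distrib_right sum.distrib)

lemma mat_mult_diff_left: "(a - b) \<star> c = a \<star> c - b \<star> c"
  by (simp add: fun_eq_iff mat_mult_def left_diff_distrib sum_subtractf)

text \<open>The right factor enters the index set, so three different sums are compared here, over
  the union of two column supports. Column finiteness matters, since \<open>sum\<close> over an
  infinite set is 0.\<close>

lemma mat_mult_add_right:
  assumes "b \<in> M" "c \<in> M"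
  shows "a \<star> (b + c) = a \<star> b + a \<star> c"
proof (intro ext)
  fix i j
  let ?F = "{k. b k j \<noteq> 0} \<union> {k. c k j \<noteq> 0}"
  have "finite ?F" using assms by (simp add: M_iff)
  then have "(a \<star> x) i j = (\<Sum>k\<in>?F. a i k * x k j)" if "x \<in> {b, c, b + c}" for x
    by (rule mat_mult_eq_sum) (use that in auto)
  then show "(a \<star> (b + c)) i j = (a \<star> b + a \<star> c) i j"
    by (simp add: distrib_left sum.distrib)
qed

lemma mat_mult_diff_right:
  assumes "b \<in> M" "c \<in> M"
  shows "a \<star> (b - c) = a \<star> b - a \<star> c"
  using mat_mult_add_right[OF M_diff[OF assms] assms(2), of a] by simp

lemma mat_mult_assoc:
  assumes "b \<in> M" "c \<in> M"
  shows "(a \<star> b) \<star> c = a \<star> (b \<star> c)"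
proof (intro ext)
  fix i j
  let ?C = "{l. c l j \<noteq> 0}"
  \<comment> \<open>All \<open>k\<close> that can contribute to either iterated sum: the rows met by
    those columns of \<open>b\<close> that column \<open>j\<close> of \<open>c\<close>
    selects.\<close>
  let ?F = "\<Union>l\<in>?C. {k. b k l \<noteq> 0}"
  have fin: "finite ?C" "finite ?F" using assms by (simp_all add: M_iff)
  have ab: "(a \<star> b) i l = (\<Sum>k\<in>?F. a i k * b k l)" if "l \<in> ?C" for l
    by (rule mat_mult_eq_sum) (use fin that in auto)
  have bc: "(b \<star> c) k j = (\<Sum>l\<in>?C. b k l * c l j)" for k
    by (simp add: mat_mult_def)
  have "{k. (b \<star> c) k j \<noteq> 0} \<subseteq> ?F"
    unfolding mat_mult_def by (force elim: sum.not_neutral_contains_not_neutral)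
  then have "(a \<star> (b \<star> c)) i j = (\<Sum>k\<in>?F. a i k * (b \<star> c) k j)"
    using fin by (intro mat_mult_eq_sum) auto
  also have "\<dots> = (\<Sum>l\<in>?C. \<Sum>k\<in>?F. a i k * b k l * c l j)"
    unfolding bc sum_distrib_left by (subst sum.swap) (simp add: mult.assoc)
  also have "\<dots> = (\<Sum>l\<in>?C. (a \<star> b) i l * c l j)"
    by (simp add: ab sum_distrib_right del: mem_Collect_eq UN_iff)
  finally show "((a \<star> b) \<star> c) i j = (a \<star> (b \<star> c)) i j"
    by (simp add: mat_mult_def)
qed

lemma M_bracket: "a \<in> M \<Longrightarrow> b \<in> M \<Longrightarrow> bracket a b \<in> M"
  by (simp add: bracket_def M_mult M_diff)

lemma M_rcf_bracket: "a \<in> M_rcf \<Longrightarrow> b \<in> M_rcf \<Longrightarrow> bracket a b \<in> M_rcf"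
  by (simp add: bracket_def M_rcf_mult M_rcf_diff)

lemma bracket_add_left:
  "a \<in> M \<Longrightarrow> b \<in> M \<Longrightarrow> bracket (a + b) c = bracket a c + bracket b c"
  by (simp add: bracket_def mat_mult_add_left mat_mult_add_right)

lemma bracket_diff_left:
  "a \<in> M \<Longrightarrow> b \<in> M \<Longrightarrow> bracket (a - b) c = bracket a c - bracket b c"
  by (simp add: bracket_def mat_mult_diff_left mat_mult_diff_right)

lemma bracket_add_right:
  "b \<in> M \<Longrightarrow> c \<in> M \<Longrightarrow> bracket a (b + c) = bracket a b + bracket a c"
  by (simp add: bracket_def mat_mult_add_left mat_mult_add_right)

lemma bracket_diff_right:
  "b \<in> M \<Longrightarrow> c \<in> M \<Longrightarrow> bracket a (b - c) = bracket a b - bracket a c"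
  by (simp add: bracket_def mat_mult_diff_left mat_mult_diff_right)

lemma bracket_zero [simp]: "bracket 0 a = 0" "bracket a 0 = 0"
  by (simp_all add: bracket_def mat_mult_def fun_eq_iff)

lemma bracket_jacobi:
  "a \<in> M \<Longrightarrow> b \<in> M \<Longrightarrow> c \<in> M \<Longrightarrow>
    bracket a (bracket b c) = bracket (bracket a b) c + bracket b (bracket a c)"
  by (simp add: bracket_def mat_mult_diff_left mat_mult_diff_right M_mult mat_mult_assoc)

section \<open>Matrix units\<close>

definition mat_unit :: "'i \<Rightarrow> 'i \<Rightarrow> 'r \<Rightarrow> ('i, 'r::zero) matrix" where
  "mat_unit i j r = (\<lambda>p q. if p = i \<and> q = j then r else 0)"

lemma mat_unit_apply: "mat_unit i j r p q = (if p = i \<and> q = j then r else 0)"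
  by (simp add: mat_unit_def)

lemma M_inf_subset_M_rcf: "M_inf \<subseteq> (M_rcf :: ('i, 'r::zero) matrix set)"
proof
  fix a :: "('i, 'r) matrix"
  assume "a \<in> M_inf"
  then have fin: "finite {(i, j). a i j \<noteq> 0}" by (simp add: M_inf_def)
  have "finite {i. a i j \<noteq> 0}" for j
    by (rule finite_subset[OF _ finite_imageI[OF fin, of fst]]) force
  moreover have "finite {j. a i j \<noteq> 0}" for i
    by (rule finite_subset[OF _ finite_imageI[OF fin, of snd]]) force
  ultimately show "a \<in> M_rcf"
    by (simp add: M_rcf_iff M_iff)
qed

lemma mat_unit_in_M_inf: "mat_unit i j r \<in> M_inf"
proof -
  have "{(p, q). mat_unit i j r p q \<noteq> 0} \<subseteq> {(i, j)}" by (auto simp: mat_unit_def)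
  then show ?thesis unfolding M_inf_def by (auto intro: finite_subset)
qed

lemma mat_unit_in_M_rcf: "mat_unit i j r \<in> M_rcf"
  using mat_unit_in_M_inf M_inf_subset_M_rcf by (rule rev_subsetD)

lemma mat_unit_in_M [simp]: "mat_unit i j r \<in> M"
  using mat_unit_in_M_rcf[of i j r] by (simp add: M_rcf_iff)

lemma mat_unit_zero [simp]: "mat_unit i j 0 = 0"
  by (simp add: fun_eq_iff mat_unit_def)

lemma mat_mult_unit_right:
  "(x \<star> mat_unit i j r) p q = (if q = j then x p i * r else 0)"
proof -
  have "(x \<star> mat_unit i j r) p q = x p i * mat_unit i j r i q"
    by (rule mat_mult_eq_single) (auto simp: mat_unit_def)
  then show ?thesis by (simp add: mat_unit_def)
qed

lemma mat_mult_unit_left: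
  assumes "x \<in> M"
  shows "(mat_unit i j r \<star> x) p q = (if p = i then r * x j q else 0)"
proof -
  have "(mat_unit i j r \<star> x) p q = mat_unit i j r p j * x j q"
    by (rule mat_mult_eq_single) (use assms in \<open>auto simp: mat_unit_def M_iff\<close>)
  then show ?thesis by (simp add: mat_unit_def)
qed

lemma bracket_unit_right:
  "x \<in> M \<Longrightarrow> bracket x (mat_unit i j r) p q =
    (if q = j then x p i * r else 0) - (if p = i then r * x j q else 0)"
  by (simp add: bracket_def mat_mult_unit_left mat_mult_unit_right)

lemma bracket_unit_left:
  "x \<in> M \<Longrightarrow> bracket (mat_unit i j r) x p q =
    (if p = i then r * x j q else 0) - (if q = j then x p i * r else 0)"
  by (simp add: bracket_def mat_mult_unit_left mat_mult_unit_right)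

lemma bracket_unit_unit:
  "bracket (mat_unit i j r) (mat_unit k l s) =
    mat_unit i l (if j = k then r * s else 0) - mat_unit k j (if i = l then s * r else 0)"
  by (intro ext, subst bracket_unit_left) (auto, auto simp: mat_unit_def)

text \<open>A finite set \<open>F\<close> containing the support shrinks when one entry is
  subtracted as a matrix unit. Letting \<open>F\<close> exceed the support avoids a case distinction
  on whether that entry is zero.\<close>

lemma M_inf_induct [consumes 1, case_names zero unit add]:
  assumes "x \<in> M_inf" "P 0" "\<And>i j r. P (mat_unit i j r)"
    and "\<And>x y. x \<in> M_inf \<Longrightarrow> y \<in> M_inf \<Longrightarrow> P x \<Longrightarrow> P y \<Longrightarrow> P (x + y)"
  shows "P (x :: ('i, 'r::ring) matrix)"
proof -
  have "\<forall>x :: ('i, 'r) matrix. {(i, j). x i j \<noteq> 0} \<subseteq> F \<longrightarrow> x \<in> M_inf \<and> P x"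
    if "finite F" for F
    using that
  proof (induction F)
    case empty
    show ?case
    proof (intro allI impI)
      fix x :: "('i, 'r) matrix"
      assume "{(i, j). x i j \<noteq> 0} \<subseteq> {}"
      then have "x = 0" by (intro ext) auto
      then show "x \<in> M_inf \<and> P x" using assms(2) by (simp only: M_inf_def) simp
    qed
  next
    case (insert e F)
    show ?case
    proof (intro allI impI)
      fix x :: "('i, 'r) matrix"
      assume x: "{(i, j). x i j \<noteq> 0} \<subseteq> insert e F"
      obtain i j where e: "e = (i, j)" by (cases e)
      define y where "y = x - mat_unit i j (x i j)"
      have "{(i, j). y i j \<noteq> 0} \<subseteq> F"
        using x e by (auto simp: y_def mat_unit_def split: if_splits)
      then have "y \<in> M_inf \<and> P y" using insert.IH by blast
      then have "P (y + mat_unit i j (x i j))"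
        by (intro assms(3,4) mat_unit_in_M_inf) simp_all
      moreover have "finite {(i, j). x i j \<noteq> 0}"
        by (rule finite_subset[OF x]) (simp add: insert.hyps(1))
      ultimately show "x \<in> M_inf \<and> P x"
        by (simp add: y_def M_inf_def)
    qed
  qed
  from this[of "{(i, j). x i j \<noteq> 0}"] show ?thesis
    using assms(1) by (simp add: M_inf_def)
qed

section \<open>Generators of the finitary special linear Lie ring\<close>

lemma sl_inf_zero: "0 \<in> sl_inf" by (simp add: sl_inf_def)

lemma sl_inf_diff: "x \<in> sl_inf \<Longrightarrow> y \<in> sl_inf \<Longrightarrow> x - y \<in> sl_inf"
  unfolding sl_inf_def by (rule group_closure.diff)

lemma sl_inf_add: "x \<in> sl_inf \<Longrightarrow> y \<in> sl_inf \<Longrightarrow> x + y \<in> sl_inf"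
  unfolding sl_inf_def by (rule group_closure_add)

lemma bracket_in_sl_inf: "x \<in> M_inf \<Longrightarrow> y \<in> M_inf \<Longrightarrow> bracket x y \<in> sl_inf"
  unfolding sl_inf_def by (rule group_closure.base) blast

text \<open>Bracketing with the idempotent \<open>mat_unit i i 1\<close> fixes
  \<open>mat_unit i j r\<close> when \<open>i \<noteq> j\<close>.\<close>

lemma mat_unit_in_sl_inf:
  fixes r :: "'r::{ring,monoid_mult}"
  assumes "i \<noteq> j"
  shows "mat_unit i j r \<in> sl_inf"
  using bracket_in_sl_inf[OF mat_unit_in_M_inf mat_unit_in_M_inf, of i i 1 i j r] assms
  by (simp add: bracket_unit_unit)

lemma mat_unit_commutator_in_sl_inf: "mat_unit i i (r * s) - mat_unit j j (s * r) \<in> sl_inf"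
  using bracket_in_sl_inf[OF mat_unit_in_M_inf mat_unit_in_M_inf, of i j r j i s]
  by (simp add: bracket_unit_unit)

text \<open>By biadditivity every generator reduces to brackets of matrix units. Each of these is
  either a diagonal commutator term or a difference of terms that are off-diagonal units or zero.
  Differences rather than sums match the closure rule of \<open>group_closure\<close>.\<close>

lemma sl_inf_induct [consumes 2, case_names zero unit commutator diff]:
  fixes x :: "('i, 'r::{ring,monoid_mult}) matrix"
  assumes x: "x \<in> sl_inf" and inf: "infinite (UNIV :: 'i set)"
    and zero: "P 0"
    and unit: "\<And>i j r. i \<noteq> j \<Longrightarrow> P (mat_unit i j r)"
    and comm: "\<And>i j r s. i \<noteq> j \<Longrightarrow> P (mat_unit i i (r * s) - mat_unit j j (s * r))"
    and diff: "\<And>x y. x \<in> sl_inf \<Longrightarrow> y \<in> sl_inf \<Longrightarrow> P x \<Longrightarrow> P y \<Longrightarrow> P (x - y)"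
  shows "P x"
proof -
  define Q where "Q x \<longleftrightarrow> x \<in> sl_inf \<and> P x" for x
  have Q_zero: "Q 0" using zero by (simp add: Q_def sl_inf_zero)
  have Q_diff: "Q x \<Longrightarrow> Q y \<Longrightarrow> Q (x - y)" for x y
    using diff by (simp add: Q_def sl_inf_diff)
  have Q_add: "Q (x + y)" if "Q x" "Q y" for x y
    using Q_diff[OF that(1) Q_diff[OF Q_zero that(2)]] by simp
  have Q_unit: "Q (mat_unit i j r)" if "i \<noteq> j" for i j r
    using that unit by (simp add: Q_def mat_unit_in_sl_inf)
  have Q_comm: "Q (mat_unit i i (r * s) - mat_unit j j (s * r))" for i j r s
  proof (cases "i = j")
    case False
    then show ?thesis using comm by (simp add: Q_def mat_unit_commutator_in_sl_inf)
  next
    case True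
    \<comment> \<open>For \<open>i = j\<close> the commutator sits in a single diagonal entry; a
      further index \<open>k\<close> splits it into a difference of two admissible terms, the second
      with factors \<open>s * r\<close> and \<open>1\<close>.\<close>
    obtain k where "k \<noteq> i" using ex_new_if_finite[OF inf, of "{i}"] by auto
    then have "Q (mat_unit i i (r * s) - mat_unit k k (s * r) - 
        (mat_unit i i (s * r * 1) - mat_unit k k (1 * (s * r))))"
      by (intro Q_diff[of "_ - _" "_ - _"])
        (simp_all only: Q_def mat_unit_commutator_in_sl_inf comm simp_thms not_sym)
    then show ?thesis using True by simp
  qed
  have Q_units: "Q (bracket (mat_unit i j r) (mat_unit k l s))" for i j k l r s
  proof (cases "i = l \<and> j = k")
    case True
    then show ?thesis using Q_comm[of i r s j] by (simp add: bracket_unit_unit)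
  next
    case False
    then have "Q (mat_unit i l (if j = k then r * s else 0))"
      "Q (mat_unit k j (if i = l then s * r else 0))"
      using Q_unit Q_zero by auto
    then show ?thesis unfolding bracket_unit_unit by (rule Q_diff)
  qed
  have M_inf_M: "x \<in> M" if "x \<in> M_inf" for x :: "('i, 'r) matrix"
    using that M_inf_subset_M_rcf M_rcf_iff by blast
  have "Q (bracket a b)" if a: "a \<in> M_inf" and b: "b \<in> M_inf" for a b
    using a
  proof (induction a rule: M_inf_induct)
    case zero
    then show ?case by (simp only: bracket_zero Q_zero)
  next
    case (unit i j r)
    show ?case using b
    proof (induction b rule: M_inf_induct)
      case zero
      then show ?case by (simp only: bracket_zero Q_zero)
    next
      case (unit k l s)
      then show ?case by (rule Q_units)
    next
      case (add x y)
      then show ?case by (simp only: bracket_add_right M_inf_M Q_add)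
    qed
  next
    case (add x y)
    then show ?case by (simp only: bracket_add_left M_inf_M Q_add)
  qed
  moreover have "Q x" if "\<And>a b. a \<in> M_inf \<Longrightarrow> b \<in> M_inf \<Longrightarrow> Q (bracket a b)"
    using x unfolding sl_inf_def
  proof (induction rule: group_closure.induct)
    case (base s)
    then show ?case using that Q_zero by blast
  next
    case (diff s t)
    show ?case using diff(3,4) by (rule Q_diff)
  qed
  ultimately show ?thesis by (simp add: Q_def)
qed

lemma sl_inf_subset_M_rcf: "sl_inf \<subseteq> (M_rcf :: ('i, 'r::{ring,monoid_mult}) matrix set)"
  if "infinite (UNIV :: 'i set)"
proof
  fix x :: "('i, 'r) matrix"
  assume "x \<in> sl_inf"
  then show "x \<in> M_rcf" using that
  proof (induction rule: sl_inf_induct)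
    case zero
    then show ?case by (rule M_zero)
  next
    case (unit i j r)
    show ?case by (rule mat_unit_in_M_rcf)
  next
    case (commutator i j r s)
    show ?case by (intro M_rcf_diff mat_unit_in_M_rcf)
  next
    case (diff x y)
    show ?case using diff(3,4) by (rule M_rcf_diff)
  qed
qed

section \<open>Derivations with values in column-finite matrices\<close>

text \<open>Values are only required to lie in \<open>M\<close>, so that restrictions to
  \<open>sl_inf\<close> of derivations of \<open>gl\<close> and \<open>gl_rcf\<close> are covered;
  these need not map \<open>sl_inf\<close> into itself.\<close>

definition derivation_into ::
    "('i, 'r::ring) matrix set \<Rightarrow> (('i, 'r) matrix \<Rightarrow> ('i, 'r) matrix) \<Rightarrow> bool" where
  "derivation_into L d \<longleftrightarrow>
     (\<forall>x\<in>L. d x \<in> M) \<and>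
     (\<forall>x\<in>L. \<forall>y\<in>L. d (x + y) = d x + d y) \<and>
     (\<forall>x\<in>L. \<forall>y\<in>L. d (bracket x y) = bracket (d x) y + bracket x (d y))"

lemma derivation_into_mem: "derivation_into L d \<Longrightarrow> x \<in> L \<Longrightarrow> d x \<in> M"
  by (simp add: derivation_into_def)

lemma derivation_into_add:
  "derivation_into L d \<Longrightarrow> x \<in> L \<Longrightarrow> y \<in> L \<Longrightarrow> d (x + y) = d x + d y"
  by (simp add: derivation_into_def)

lemma derivation_into_bracket:
  "derivation_into L d \<Longrightarrow> x \<in> L \<Longrightarrow> y \<in> L \<Longrightarrow>
    d (bracket x y) = bracket (d x) y + bracket x (d y)"
  by (simp add: derivation_into_def)

lemma derivation_into_zero:
  assumes "derivation_into L d" "0 \<in> L"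
  shows "d 0 = 0"
  using derivation_into_add[OF assms assms(2)] by simp

lemma derivation_into_diff:
  assumes "derivation_into L d" "x - y \<in> L" "y \<in> L"
  shows "d (x - y) = d x - d y"
  using derivation_into_add[OF assms] by (simp add: algebra_simps)

lemma lie_derivation_imp_derivation_into:
  "lie_derivation L d \<Longrightarrow> L \<subseteq> M \<Longrightarrow> derivation_into L d"
  by (auto simp: lie_derivation_def derivation_into_def)

lemma derivation_into_subset: "derivation_into L d \<Longrightarrow> K \<subseteq> L \<Longrightarrow> derivation_into K d"
  by (simp add: derivation_into_def subset_iff)

lemma derivation_into_minus:
  assumes d: "derivation_into L d" "derivation_into L e" and L: "L \<subseteq> M"
  shows "derivation_into L (\<lambda>x. d x - e x)"
  unfolding derivation_into_def
proof (intro conjI ballI)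
  fix x y assume xy: "x \<in> L" "y \<in> L"
  have M: "x \<in> M" "y \<in> M" "d x \<in> M" "d y \<in> M" "e x \<in> M" "e y \<in> M"
    using xy L by (auto intro: derivation_into_mem[OF d(1)] derivation_into_mem[OF d(2)])
  show "d x - e x \<in> M" by (simp add: M_diff M)
  show "d (x + y) - e (x + y) = d x - e x + (d y - e y)"
    by (simp add: derivation_into_add[OF d(1) xy] derivation_into_add[OF d(2) xy])
  show "d (bracket x y) - e (bracket x y) = bracket (d x - e x) y + bracket x (d y - e y)"
    by (simp add: derivation_into_bracket[OF d(1) xy] derivation_into_bracket[OF d(2) xy]
        bracket_diff_left bracket_diff_right M)
qed

lemma derivation_into_ad:
  assumes "a \<in> M" "L \<subseteq> M"
  shows "derivation_into L (ad a)"
  using assms unfolding derivation_into_def ad_def subset_iff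
  by (intro conjI ballI bracket_jacobi) (simp_all add: M_bracket bracket_add_right)

section \<open>Derivations of the scalar ring acting entrywise\<close>

lemma Der_add: "u \<in> Der \<Longrightarrow> u (x + y) = u x + u y"
  by (simp add: Der_def)

lemma Der_zero: "u \<in> Der \<Longrightarrow> u 0 = 0"
  using Der_add[of u 0 0] by simp

lemma Der_mult: "u \<in> Der \<Longrightarrow> u (x * y) = u x * y + x * u y"
  by (simp add: Der_def)

lemma Der_diff: "u \<in> Der \<Longrightarrow> u (x - y) = u x - u y"
  using Der_add[of u "x - y" y] by (simp add: algebra_simps)

lemma Der_sum: "u \<in> Der \<Longrightarrow> u (sum f A) = (\<Sum>x\<in>A. u (f x))"
  by (induction A rule: infinite_finite_induct) (simp_all add: Der_zero Der_add)

lemma entrywise_in_M: "u \<in> Der \<Longrightarrow> x \<in> M \<Longrightarrow> entrywise u x \<in> M"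
  unfolding M_iff entrywise_def
  by (intro allI, rule_tac B = "{i. x i j \<noteq> 0}" in finite_subset) (auto simp: Der_zero)

lemma entrywise_mat_mult:
  assumes u: "u \<in> Der" and y: "y \<in> M"
  shows "entrywise u (x \<star> y) = entrywise u x \<star> y + x \<star> entrywise u y"
proof (intro ext)
  fix i j
  let ?F = "{k. y k j \<noteq> 0}"
  have F: "finite ?F" using y by (simp add: M_iff)
  have "(x \<star> entrywise u y) i j = (\<Sum>k\<in>?F. x i k * u (y k j))"
    by (subst mat_mult_eq_sum[OF F]) (auto simp: entrywise_def Der_zero[OF u])
  then show "entrywise u (x \<star> y) i j = (entrywise u x \<star> y + x \<star> entrywise u y) i j"
    by (simp add: mat_mult_def entrywise_def Der_sum[OF u] Der_mult[OF u] sum.distrib)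
qed

lemma derivation_into_entrywise:
  assumes u: "u \<in> Der" and L: "L \<subseteq> M"
  shows "derivation_into L (entrywise u)"
  unfolding derivation_into_def
proof (intro conjI ballI)
  fix x y assume "x \<in> L" "y \<in> L"
  then have M: "x \<in> M" "y \<in> M" using L by auto
  show "entrywise u x \<in> M" using u M(1) by (rule entrywise_in_M)
  show "entrywise u (x + y) = entrywise u x + entrywise u y"
    by (simp add: entrywise_def fun_eq_iff Der_add[OF u])
  have "entrywise u (bracket x y) = entrywise u (x \<star> y) - entrywise u (y \<star> x)"
    by (simp add: entrywise_def fun_eq_iff bracket_def Der_diff[OF u])
  then show "entrywise u (bracket x y) = bracket (entrywise u x) y + bracket x (entrywise u y)"
    by (simp add: entrywise_mat_mult u M bracket_def)
qed

section \<open>Derivations on the finitary special linear Lie ring\<close>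

lemma ex_notin_finite:
  assumes "infinite (UNIV :: 'i set)"
  shows "\<exists>k::'i. k \<notin> set xs"
  using ex_new_if_finite[OF assms finite_set] .

text \<open>These replace the idempotents \<open>mat_unit s s 1\<close>, which need not lie in
  \<open>sl_inf\<close>.\<close>

definition mat_h :: "'i \<Rightarrow> 'i \<Rightarrow> ('i, 'r::{ring,monoid_mult}) matrix" where
  "mat_h s t = mat_unit s s 1 - mat_unit t t 1"

text \<open>The diagonal entry of \<open>mat_h s t\<close> at \<open>p\<close>. Bracketing with
  \<open>mat_h s t\<close> scales entry \<open>(p, q)\<close> by the difference of the weights of
  \<open>p\<close> and \<open>q\<close>; all values are 0, 1 or -1, hence central.\<close>

definition weight :: "'i \<Rightarrow> 'i \<Rightarrow> 'i \<Rightarrow> 'r::{ring,monoid_mult}" where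
  "weight s t p = (if p = s then 1 else 0) - (if p = t then 1 else 0)"

lemma mat_h_in_sl_inf: "mat_h s t \<in> (sl_inf :: ('i, 'r::{ring,monoid_mult}) matrix set)"
  unfolding mat_h_def
  using bracket_in_sl_inf[OF mat_unit_in_M_inf mat_unit_in_M_inf, of s t "1 :: 'r" t s 1]
  by (simp add: bracket_unit_unit)

lemma mat_h_in_M [simp]: "mat_h s t \<in> M"
  by (simp add: mat_h_def M_diff)

lemma bracket_mat_h_right:
  "x \<in> M \<Longrightarrow> bracket x (mat_h s t) p q = x p q * (weight s t q - weight s t p)"
  by (simp add: mat_h_def bracket_diff_right bracket_unit_right weight_def algebra_simps)

lemma bracket_mat_h_left:
  "x \<in> M \<Longrightarrow> bracket (mat_h s t) x p q = (weight s t p - weight s t q) * x p q"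
  by (simp add: mat_h_def bracket_diff_left bracket_unit_left weight_def algebra_simps)

lemma bracket_mat_h_unit:
  "bracket (mat_h s t) (mat_unit i j r) = mat_unit i j ((weight s t i - weight s t j) * r)"
  by (intro ext) (simp add: bracket_mat_h_left mat_unit_apply)

lemma bracket_mat_h_mat_h: "bracket (mat_h s t) (mat_h p q) = 0"
  by (simp add: bracket_mat_h_unit bracket_diff_right mat_h_def[of p q])

lemma weight_commute: "weight s t p * x = x * weight s t p"
  by (simp add: weight_def)

text \<open>Apply \<open>d\<close> to the bracket of two commuting diagonal matrices and read off
  entry \<open>(p, q)\<close>. Wherever the weight difference is invertible, the entry divided by it
  does not depend on the diagonal matrix chosen.\<close>

lemma derivation_mat_h_symmetric:
  assumes d: "derivation_into sl_inf d"
  shows "d (mat_h s t) p q * (weight s' t' q - weight s' t' p) =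
    d (mat_h s' t') p q * (weight s t q - weight s t p)"
proof -
  have "bracket (d (mat_h s t)) (mat_h s' t') + bracket (mat_h s t) (d (mat_h s' t')) = 0"
    using derivation_into_bracket[OF d mat_h_in_sl_inf mat_h_in_sl_inf]
      derivation_into_zero[OF d sl_inf_zero] by (simp add: bracket_mat_h_mat_h)
  then have "(bracket (d (mat_h s t)) (mat_h s' t') + bracket (mat_h s t) (d (mat_h s' t'))) p q = 0"
    by simp
  then show ?thesis
    by (simp add: bracket_mat_h_right bracket_mat_h_left derivation_into_mem[OF d mat_h_in_sl_inf])
       (simp add: algebra_simps weight_commute)
qed

lemma derivation_eq_ad_on_mat_h:
  fixes d :: "('i, 'r::{ring,monoid_mult}) matrix \<Rightarrow> ('i, 'r) matrix"
  assumes d: "derivation_into sl_inf d" and inf: "infinite (UNIV :: 'i set)"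
  obtains a where "a \<in> M" "\<forall>x\<in>sl_inf. d x \<in> M_rcf \<Longrightarrow> a \<in> M_rcf"
    "\<And>s t p q. p \<noteq> q \<Longrightarrow> d (mat_h s t) p q = bracket a (mat_h s t) p q"
proof -
  define a where "a p q = (if p = q then 0 else d (mat_h q (SOME r. r \<notin> set [p, q])) p q)" for p q
  have a_some: "a p q * (weight s t q - weight s t p) = d (mat_h s t) p q" if "p \<noteq> q" for p q s t
  proof -
    define r where "r = (SOME r. r \<notin> set [p, q])"
    have "r \<notin> set [p, q]"
      unfolding r_def by (rule someI_ex) (rule ex_notin_finite[OF inf])
    then have "weight q r q - weight q r p = (1 :: 'r)"
      using that by (auto simp: weight_def)
    then show ?thesis
      using derivation_mat_h_symmetric[OF d, of q r p q s t] that
      by (simp only: a_def r_def[symmetric] if_False mult_1_right)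
  qed
  \<comment> \<open>With \<open>r\<close> fixed, column \<open>q\<close> of \<open>a\<close> agrees
    outside \<open>q\<close> and \<open>r\<close> with a column of a single value of
    \<open>d\<close>, whence column finiteness. Rows work likewise, up to sign.\<close>
  have column: "a p q = d (mat_h q r) p q" if "p \<noteq> q" "p \<noteq> r" "q \<noteq> r" for p q r
    using a_some[of p q q r] that by (simp add: weight_def)
  have row: "d (mat_h p r) p q = - a p q" if "p \<noteq> q" "p \<noteq> r" "q \<noteq> r" for p q r
    using a_some[of p q p r] that by (simp add: weight_def)
  have a_M: "a \<in> M"
    unfolding M_iff
  proof
    fix q :: 'i
    obtain r where r: "r \<notin> set [q]" using ex_notin_finite[OF inf] by blast
    have "{p. a p q \<noteq> 0} \<subseteq> {q, r} \<union> {p. d (mat_h q r) p q \<noteq> 0}"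
      using column r by auto
    moreover have "finite {p. d (mat_h q r) p q \<noteq> 0}"
      using derivation_into_mem[OF d mat_h_in_sl_inf] by (simp add: M_iff)
    ultimately show "finite {p. a p q \<noteq> 0}"
      by (simp add: finite_subset)
  qed
  moreover have "a \<in> M_rcf" if rcf: "\<forall>x\<in>sl_inf. d x \<in> M_rcf"
  proof -
    have "finite {q. a p q \<noteq> 0}" for p
    proof -
      obtain r where r: "r \<notin> set [p]" using ex_notin_finite[OF inf] by blast
      have "{q. a p q \<noteq> 0} \<subseteq> {p, r} \<union> {q. d (mat_h p r) p q \<noteq> 0}"
        using row r by auto
      moreover have "finite {q. d (mat_h p r) p q \<noteq> 0}"
        using bspec[OF rcf mat_h_in_sl_inf] by (simp add: M_rcf_iff)
      ultimately show ?thesis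
        by (simp add: finite_subset)
    qed
    then show ?thesis using a_M by (simp add: M_rcf_iff)
  qed
  moreover have "d (mat_h s t) p q = bracket a (mat_h s t) p q" if "p \<noteq> q" for s t p q
    using a_some[OF that] by (simp add: bracket_mat_h_right a_M)
  ultimately show ?thesis by (rule that)
qed

text \<open>
  If the images of the \<open>mat_h s t\<close> are diagonal, the image of a matrix unit has the same weight
  with respect to them as the matrix unit itself. Only the entries \<open>(p, i)\<close> require \<open>2\<close> to be
  invertible.
\<close>

lemma derivation_mat_unit_eq:
  fixes d :: "('i, 'r::{ring,monoid_mult}) matrix \<Rightarrow> ('i, 'r) matrix"
  assumes d: "derivation_into sl_inf d" and inf: "infinite (UNIV :: 'i set)"
    and half: "\<exists>h::'r. (1 + 1) * h = 1 \<and> h * (1 + 1) = 1"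
    and diag: "\<And>s t p q. p \<noteq> q \<Longrightarrow> d (mat_h s t) p q = 0"
    and ij: "i \<noteq> j"
  shows "d (mat_unit i j r) = mat_unit i j (d (mat_unit i j r) i j)"
proof -
  let ?X = "d (mat_unit i j r)"
  have two: "x = 0" if "x = - x" for x :: 'r
  proof -
    obtain h :: 'r where h: "h * (1 + 1) = 1" using half by blast
    have "(1 + 1) * x = 0" using that by (simp add: distrib_right eq_neg_iff_add_eq_0)
    then have "(h * (1 + 1)) * x = 0" by (simp only: mult.assoc mult_zero_right)
    then show ?thesis by (simp add: h)
  qed
  have unit: "mat_unit i j r \<in> sl_inf" using ij by (rule mat_unit_in_sl_inf)
  have X: "?X p q = (weight s t p - weight s t q) * ?X p q"
    if "(p, q) \<noteq> (i, j)" "weight s t i - weight s t j = (1 :: 'r)" for s t p q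
  proof -
    have "?X = bracket (d (mat_h s t)) (mat_unit i j r) + bracket (mat_h s t) ?X"
      using derivation_into_bracket[OF d mat_h_in_sl_inf[of s t] unit] that(2)
      by (simp add: bracket_mat_h_unit)
    then have "?X p q = (bracket (d (mat_h s t)) (mat_unit i j r) + bracket (mat_h s t) ?X) p q"
      by (rule arg_cong)
    also have "\<dots> = (weight s t p - weight s t q) * ?X p q"
      using that(1) diag
      by (auto simp: bracket_unit_right bracket_mat_h_left derivation_into_mem[OF d]
          mat_h_in_sl_inf unit)
    finally show ?thesis .
  qed
  have "?X p q = 0" if pq: "(p, q) \<noteq> (i, j)" for p q
  proof -
    \<comment> \<open>Both pairs \<open>s\<close>, \<open>j\<close> and \<open>i\<close>,
      \<open>s\<close> give \<open>(i, j)\<close> weight difference 1. The first gives the remaining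
      entries of row \<open>i\<close> factor 0; the second gives all other entries factor 0, except
      -1 in column \<open>i\<close>.\<close>
    obtain s where s: "s \<notin> set [i, j, p, q]" using ex_notin_finite[OF inf] by blast
    show ?thesis
    proof (cases "p = i")
      case True
      then show ?thesis using X[OF pq, of s j] s pq ij by (auto simp: weight_def)
    next
      case False
      then show ?thesis using X[OF pq, of i s] s pq ij two
        by (cases "q = i") (auto simp: weight_def)
    qed
  qed
  then show ?thesis by (auto simp: fun_eq_iff mat_unit_apply)
qed

text \<open>The coefficients obey a cocycle rule. Subtracting the coboundary of a suitable diagonal
  matrix makes them vanish at 1; the rule with one factor 1 then shows that they depend on neither
  index.\<close>

lemma derivation_eq_ad_plus_Der_on_units:
  fixes d :: "('i, 'r::{ring,monoid_mult}) matrix \<Rightarrow> ('i, 'r) matrix"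
  assumes d: "derivation_into sl_inf d" and inf: "infinite (UNIV :: 'i set)"
    and unit: "\<And>i j r. i \<noteq> j \<Longrightarrow> d (mat_unit i j r) = mat_unit i j (d (mat_unit i j r) i j)"
  obtains b u where "b \<in> M_rcf" "u \<in> Der"
    "\<And>i j r. i \<noteq> j \<Longrightarrow>
      d (mat_unit i j r) = ad b (mat_unit i j r) + entrywise u (mat_unit i j r)"
proof -
  define c where "c i j r = d (mat_unit i j r) i j" for i j r
  have c_mult: "c i j (r * s) = c i k r * s + r * c k j s"
    if "i \<noteq> j" "i \<noteq> k" "k \<noteq> j" for i j k r s
  proof -
    have "mat_unit i j (r * s) = bracket (mat_unit i k r) (mat_unit k j s)"
      using that by (simp add: bracket_unit_unit)
    then have "d (mat_unit i j (r * s)) =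
        bracket (mat_unit i k (c i k r)) (mat_unit k j s) +
        bracket (mat_unit i k r) (mat_unit k j (c k j s))"
      using derivation_into_bracket[OF d, of "mat_unit i k r" "mat_unit k j s"] that
      by (simp add: mat_unit_in_sl_inf unit[symmetric] c_def)
    then have "d (mat_unit i j (r * s)) i j =
        (mat_unit i j (c i k r * s) + mat_unit i j (r * c k j s)) i j"
      using that by (simp add: bracket_unit_unit)
    then show ?thesis by (simp add: mat_unit_apply c_def)
  qed
  obtain o1 :: 'i where True by blast
  obtain o2 where o2: "o2 \<notin> set [o1]" using ex_notin_finite[OF inf] by blast
  \<comment> \<open>This choice, relative to the base index \<open>o1\<close>, is the one that
    forces \<open>v i o1 1 = 0\<close>.\<close>
  define b where "b i = (if i = o1 then 0 else c i o1 1)" for i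
  define B where "B = (\<lambda>p q. if p = q then b p else 0)"
  have B_apply: "B p q = (if p = q then b p else 0)" for p q
    by (simp add: B_def)
  define v where "v i j r = c i j r - (b i * r - r * b j)" for i j r
  have v_mult: "v i j (r * s) = v i k r * s + r * v k j s"
    if "i \<noteq> j" "i \<noteq> k" "k \<noteq> j" for i j k r s
    by (simp add: v_def c_mult[OF that] algebra_simps)
  have v_o1: "v i o1 1 = 0" if "i \<noteq> o1" for i
    using that by (simp add: v_def b_def)
  have v_one: "v i j 1 = 0" if "i \<noteq> j" for i j
  proof -
    \<comment> \<open>Inserting \<open>j\<close> between \<open>i\<close> and \<open>o1\<close>
      gives \<open>v i o1 1 = v i j 1 + v j o1 1\<close>. Row \<open>o1\<close> is reached
      afterwards through an auxiliary row \<open>k\<close>.\<close>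
    have *: "v i j 1 = 0" if "i \<noteq> j" "i \<noteq> o1" for i j
      using v_mult[of i o1 j 1 1] v_o1 that by (cases "j = o1") auto
    show ?thesis
    proof (cases "i = o1")
      case True
      obtain k where "k \<notin> set [o1, j]" using ex_notin_finite[OF inf] by blast
      then have k: "k \<noteq> o1" "k \<noteq> j" by auto
      obtain l where "l \<notin> set [o1, j, k]" using ex_notin_finite[OF inf] by blast
      then have l: "l \<noteq> o1" "l \<noteq> j" "l \<noteq> k" by auto
      have "v k j 1 = v k o1 1 + v o1 j 1"
        using v_mult[of k j o1 1 1] k True that by auto
      then show ?thesis using *[of k j] *[of k o1] k True by simp
    qed (use * that in blast)
  qed
  have v_col: "v i j r = v i k r" if "i \<noteq> j" "i \<noteq> k" for i j k r
    using v_mult[of i j k r 1] v_one[of k j] that by (cases "j = k") auto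
  have v_row: "v i j r = v k j r" if "i \<noteq> j" "k \<noteq> j" for i j k r
    using v_mult[of i j k 1 r] v_one[of i k] that by (cases "i = k") auto
  define u where "u = v o1 o2"
  have v_eq: "v i j = u" if "i \<noteq> j" for i j
  proof
    fix r
    \<comment> \<open>The fresh \<open>m\<close> keeps the path from \<open>(i, j)\<close> over
      \<open>(i, m)\<close> and \<open>(o1, m)\<close> to \<open>(o1, o2)\<close> off the
      diagonal.\<close>
    obtain m where "m \<notin> set [i, j, o1, o2]" using ex_notin_finite[OF inf] by blast
    then show "v i j r = u r"
      using v_col[of i j m r] v_row[of i m o1 r] v_col[of o1 m o2 r] that o2
      by (auto simp: u_def)
  qed
  have "u (x + y) = u x + u y" for x y
  proof -
    have "mat_unit o1 o2 (x + y) = mat_unit o1 o2 x + mat_unit o1 o2 y"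
      by (simp add: fun_eq_iff mat_unit_apply)
    then have "c o1 o2 (x + y) = c o1 o2 x + c o1 o2 y"
      using derivation_into_add[OF d, of "mat_unit o1 o2 x" "mat_unit o1 o2 y"] o2
      by (auto simp: c_def mat_unit_in_sl_inf)
    then show ?thesis by (simp add: u_def v_def algebra_simps)
  qed
  moreover have "u (x * y) = u x * y + x * u y" for x y
  proof -
    obtain k where "k \<notin> set [o1, o2]" using ex_notin_finite[OF inf] by blast
    then show ?thesis
      using v_mult[of o1 o2 k x y] v_eq[of o1 o2] v_eq[of o1 k] v_eq[of k o2] o2 by auto
  qed
  ultimately have u: "u \<in> Der" by (simp add: Der_def)
  have B: "B \<in> M_rcf"
  proof -
    have "finite {i. B i j \<noteq> 0}" for j
      by (rule finite_subset[of _ "{j}"]) (auto simp: B_def)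
    moreover have "finite {j. B i j \<noteq> 0}" for i
      by (rule finite_subset[of _ "{i}"]) (auto simp: B_def)
    ultimately show ?thesis by (simp add: M_rcf_iff M_iff)
  qed
  have "d (mat_unit i j r) = ad B (mat_unit i j r) + entrywise u (mat_unit i j r)"
    if "i \<noteq> j" for i j r
  proof -
    have "d (mat_unit i j r) = mat_unit i j (c i j r)"
      using unit[OF that] by (simp add: c_def)
    moreover have "c i j r = b i * r - r * b j + u r"
      using v_eq[OF that] by (simp add: v_def fun_eq_iff algebra_simps)
    moreover have "B \<in> M" using B by (simp add: M_rcf_iff)
    ultimately show ?thesis
      using that Der_zero[OF u]
      by (intro ext) (simp add: ad_def bracket_unit_right entrywise_def mat_unit_apply B_apply)
  qed
  with B u show ?thesis by (rule that)
qed

text \<open>The off-diagonal units generate \<open>sl_inf\<close> as a Lie ring: the diagonal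
  generators are brackets of \<open>mat_unit i j r\<close> with
  \<open>mat_unit j i s\<close>.\<close>

lemma derivation_zero_on_sl_inf:
  fixes d :: "('i, 'r::{ring,monoid_mult}) matrix \<Rightarrow> ('i, 'r) matrix"
  assumes d: "derivation_into sl_inf d" and inf: "infinite (UNIV :: 'i set)"
    and unit: "\<And>i j r. i \<noteq> j \<Longrightarrow> d (mat_unit i j r) = 0"
    and x: "x \<in> sl_inf"
  shows "d x = 0"
  using x inf
proof (induction rule: sl_inf_induct)
  case zero
  show ?case by (rule derivation_into_zero[OF d sl_inf_zero])
next
  case (unit i j r)
  then show ?case by (rule assms(3))
next
  case (commutator i j r s)
  then have "d (bracket (mat_unit i j r) (mat_unit j i s)) = 0"
    using derivation_into_bracket[OF d, of "mat_unit i j r" "mat_unit j i s"]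
    by (simp add: mat_unit_in_sl_inf assms(3))
  then show ?case by (simp only: bracket_unit_unit if_True simp_thms)
next
  case (diff x y)
  then show ?case
    by (simp only: derivation_into_diff[OF d sl_inf_diff] diff_self)
qed

text \<open>One form serves all three Lie rings. Row finiteness of \<open>a\<close> is inherited
  from the values of \<open>d\<close>, because the second correction \<open>b\<close> is always row-
  and column-finite.\<close>

theorem derivation_on_sl_inf:
  fixes d :: "('i, 'r::{ring,monoid_mult}) matrix \<Rightarrow> ('i, 'r) matrix"
  assumes d: "derivation_into sl_inf d" and inf: "infinite (UNIV :: 'i set)"
    and half: "\<exists>h::'r. (1 + 1) * h = 1 \<and> h * (1 + 1) = 1"
  obtains a u where "a \<in> M" "\<forall>x\<in>sl_inf. d x \<in> M_rcf \<Longrightarrow> a \<in> M_rcf" "u \<in> Der"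
    "\<And>x. x \<in> sl_inf \<Longrightarrow> d x = ad a x + entrywise u x"
proof -
  have sl: "sl_inf \<subseteq> (M :: ('i, 'r) matrix set)"
    using sl_inf_subset_M_rcf[OF inf] M_rcf_iff by blast
  obtain a where a: "a \<in> M" "\<forall>x\<in>sl_inf. d x \<in> M_rcf \<Longrightarrow> a \<in> M_rcf"
    "\<And>s t p q. p \<noteq> q \<Longrightarrow> d (mat_h s t) p q = bracket a (mat_h s t) p q"
    using derivation_eq_ad_on_mat_h[OF d inf] by blast
  define d1 where "d1 x = d x - ad a x" for x
  have d1: "derivation_into sl_inf d1"
    using derivation_into_minus[OF d derivation_into_ad[OF a(1) sl] sl]
    by (simp only: d1_def[abs_def])
  have "d1 (mat_h s t) p q = 0" if "p \<noteq> q" for s t p q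
    using a(3)[OF that] by (simp add: d1_def ad_def)
  from derivation_mat_unit_eq[OF d1 inf half this]
  obtain b u where b: "b \<in> M_rcf" and u: "u \<in> Der" and
    d1_unit: "\<And>i j r. i \<noteq> j \<Longrightarrow>
      d1 (mat_unit i j r) = ad b (mat_unit i j r) + entrywise u (mat_unit i j r)"
    using derivation_eq_ad_plus_Der_on_units[OF d1 inf] by blast
  have b_M: "b \<in> M" using b by (simp add: M_rcf_iff)
  define d2 where "d2 x = d1 x - ad b x - entrywise u x" for x
  have d2: "derivation_into sl_inf d2"
    using derivation_into_minus[OF derivation_into_minus[OF d1 derivation_into_ad[OF b_M sl] sl]
        derivation_into_entrywise[OF u sl] sl]
    by (simp only: d2_def[abs_def])
  have "d2 x = 0" if "x \<in> sl_inf" for x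
    by (rule derivation_zero_on_sl_inf[OF d2 inf _ that]) (simp add: d2_def d1_unit)
  then have "d x = ad (a + b) x + entrywise u x" if "x \<in> sl_inf" for x
    using that by (simp add: d2_def d1_def ad_def bracket_add_left a b_M algebra_simps)
  moreover have "a + b \<in> M" using a(1) b_M by (rule M_add)
  moreover have "a + b \<in> M_rcf" if "\<forall>x\<in>sl_inf. d x \<in> M_rcf"
    using a(2)[OF that] b by (rule M_rcf_add)
  ultimately show ?thesis using u by (intro that[of "a + b" u])
qed

section \<open>Extension to infinite matrices\<close>

text \<open>The inner bracket lives on column \<open>j\<close> and the possibly infinite row
  \<open>i\<close>. The outer one uses only its column \<open>j\<close> and row \<open>l\<close>, so
  of row \<open>i\<close> just the entry in column \<open>j\<close> survives.\<close>

lemma double_bracket_units: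
  fixes x :: "('i, 'r::{ring,monoid_mult}) matrix"
  assumes "x \<in> M" "i \<noteq> j" "j \<noteq> l" "i \<noteq> l"
  shows "bracket (bracket x (mat_unit i j r)) (mat_unit j l 1) p q =
    (if q = l then x p i * r else 0) - mat_unit i l (r * x j j) p q - mat_unit j j (x l i * r) p q"
  using assms by (simp add: bracket_unit_right M_bracket mat_unit_apply)

lemma finite_column_in_sl_inf:
  fixes f :: "'i \<Rightarrow> 'r::{ring,monoid_mult}"
  assumes "finite F" "l \<notin> F"
  shows "(\<lambda>p q. if q = l \<and> p \<in> F then f p else 0) \<in> sl_inf"
  using assms
proof (induction F)
  case empty
  have "(\<lambda>p q. if q = l \<and> p \<in> {} then f p else 0) = (0 :: ('i, 'r) matrix)"
    by (simp add: fun_eq_iff)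
  then show ?case using sl_inf_zero by (simp only:)
next
  case (insert k F)
  have "(\<lambda>p q. if q = l \<and> p \<in> insert k F then f p else 0) =
      (\<lambda>p q. if q = l \<and> p \<in> F then f p else 0) + mat_unit k l (f k)"
    using insert.hyps by (auto simp: fun_eq_iff mat_unit_apply)
  moreover have "(\<lambda>p q. if q = l \<and> p \<in> F then f p else 0) + mat_unit k l (f k) \<in> sl_inf"
    using insert.prems insert.IH by (intro sl_inf_add mat_unit_in_sl_inf) auto
  ultimately show ?case by (simp only:)
qed

text \<open>The only diagonal entries are \<open>x l i * r\<close> at \<open>l\<close> and its
  negative at \<open>j\<close>, which together form a commutator term; the rest is a finite sum of
  off-diagonal units.\<close>

lemma double_bracket_units_in_sl_inf:
  fixes x :: "('i, 'r::{ring,monoid_mult}) matrix"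
  assumes x: "x \<in> M" and ijl: "i \<noteq> j" "j \<noteq> l" "i \<noteq> l"
  shows "bracket (bracket x (mat_unit i j r)) (mat_unit j l 1) \<in> sl_inf"
proof -
  let ?F = "{p. x p i \<noteq> 0} - {l}"
  let ?C = "\<lambda>p q. if q = l \<and> p \<in> ?F then x p i * r else 0"
  have "?C \<in> sl_inf"
    using x by (intro finite_column_in_sl_inf) (auto simp: M_iff)
  moreover have "mat_unit l l (x l i * r) - mat_unit j j (x l i * r) \<in> sl_inf"
    using mat_unit_commutator_in_sl_inf[of l "x l i * r" "1 :: 'r" j] by simp
  moreover have "mat_unit i l (r * x j j) \<in> sl_inf"
    using ijl(3) by (rule mat_unit_in_sl_inf)
  ultimately have "?C + (mat_unit l l (x l i * r) - mat_unit j j (x l i * r))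
      - mat_unit i l (r * x j j) \<in> sl_inf"
    by (intro sl_inf_diff[of "_ + _"] sl_inf_add)
  moreover have "bracket (bracket x (mat_unit i j r)) (mat_unit j l 1) =
      ?C + (mat_unit l l (x l i * r) - mat_unit j j (x l i * r)) - mat_unit i l (r * x j j)"
    using ijl by (intro ext, subst double_bracket_units[OF x ijl]) (auto simp: mat_unit_apply)
  ultimately show ?thesis by (simp only:)
qed

text \<open>Entry \<open>(p, l)\<close> of the double bracket isolates \<open>D p i\<close>, and
  entry \<open>(i, l)\<close> gives \<open>D i i * r = r * D j j\<close>. Taking
  \<open>r = 1\<close> makes the diagonal constant, and general \<open>r\<close> makes it
  central.\<close>

lemma central_scalar_if_double_brackets_zero:
  fixes D :: "('i, 'r::{ring,monoid_mult}) matrix"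
  assumes D: "D \<in> M" and inf: "infinite (UNIV :: 'i set)"
    and zero: "\<And>i j l r. i \<noteq> j \<Longrightarrow> j \<noteq> l \<Longrightarrow> i \<noteq> l \<Longrightarrow>
      bracket (bracket D (mat_unit i j r)) (mat_unit j l 1) = 0"
  obtains c where "D = (\<lambda>p q. if p = q then c else 0)" "\<And>r. c * r = r * c"
proof -
  have off: "D p i = 0" if "p \<noteq> i" for p i
  proof -
    obtain j where j: "j \<notin> set [p, i]" using ex_notin_finite[OF inf] by blast
    obtain l where l: "l \<notin> set [p, i, j]" using ex_notin_finite[OF inf] by blast
    show ?thesis
      using double_bracket_units[OF D, of i j l 1 p l] zero[of i j l 1] j l that
      by (auto simp: mat_unit_apply)
  qed
  have diag: "D i i * r = r * D j j" if "i \<noteq> j" for i j r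
  proof -
    obtain l where l: "l \<notin> set [i, j]" using ex_notin_finite[OF inf] by blast
    show ?thesis
      using double_bracket_units[OF D, of i j l r i l] zero[of i j l r] l that
      by (auto simp: mat_unit_apply)
  qed
  obtain o1 :: 'i where True by blast
  obtain o2 where o2: "o2 \<notin> set [o1]" using ex_notin_finite[OF inf] by blast
  have const: "D i i = D o1 o1" for i
    using diag[of i o1 1] by (cases "i = o1") auto
  have "D = (\<lambda>p q. if p = q then D o1 o1 else 0)"
    using off const by (auto simp: fun_eq_iff)
  moreover have "D o1 o1 * r = r * D o1 o1" for r
    using diag[of o1 o2 r] const[of o2] o2 by auto
  ultimately show ?thesis by (rule that)
qed

lemma bracket_central_scalar:
  fixes y :: "('i, 'r::ring) matrix"
  assumes y: "y \<in> M" and c: "\<And>r. c * r = r * c"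
  shows "bracket (\<lambda>p q. if p = q then c else 0) y = 0"
    and "bracket y (\<lambda>p q. if p = q then c else 0) = 0"
proof -
  define C where "C = (\<lambda>(p::'i) (q::'i). if p = q then c else 0)"
  have "(C \<star> y) p q = C p p * y p q" for p q
    by (rule mat_mult_eq_single) (use y in \<open>auto simp: C_def M_iff\<close>)
  moreover have "(y \<star> C) p q = y p q * C q q" for p q
    by (rule mat_mult_eq_single) (auto simp: C_def)
  ultimately have "C \<star> y = y \<star> C"
    by (intro ext) (simp add: C_def c)
  then have "bracket C y = 0" "bracket y C = 0"
    by (simp_all add: bracket_def)
  then show "bracket (\<lambda>p q. if p = q then c else 0) y = 0"
    "bracket y (\<lambda>p q. if p = q then c else 0) = 0"
    by (simp_all only: C_def)
qed

section \<open>Transport along injections and vanishing of additive maps\<close>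

definition transport :: "('i \<Rightarrow> 'i) \<Rightarrow> ('i, 'r::zero) matrix \<Rightarrow> ('i, 'r) matrix" where
  "transport f x =
    (\<lambda>p q. if p \<in> range f \<and> q \<in> range f then x (inv f p) (inv f q) else 0)"

definition transport_rows :: "('i \<Rightarrow> 'i) \<Rightarrow> ('i, 'r::zero) matrix \<Rightarrow> ('i, 'r) matrix" where
  "transport_rows f x = (\<lambda>p q. if p \<in> range f then x (inv f p) q else 0)"

text \<open>Write \<open>P\<close> for this matrix and \<open>P'\<close> for its transpose. For
  injective \<open>f\<close>, \<open>transport_rows f x\<close> is \<open>P' \<star> x\<close>, and
  \<open>transport f x\<close> is \<open>P' \<star> x \<star> P\<close>.\<close>

definition pullback_matrix :: "('i \<Rightarrow> 'i) \<Rightarrow> ('i, 'r::{ring,monoid_mult}) matrix" where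
  "pullback_matrix f = (\<lambda>p q. if q = f p then 1 else 0)"

lemma transport_in:
  fixes x :: "('i, 'r::zero) matrix"
  assumes f: "inj f" and L: "L = M \<or> L = M_rcf" and x: "x \<in> L"
  shows "transport f x \<in> L"
proof -
  have "finite {p. transport f x p q \<noteq> 0}" if "finite {i. x i (inv f q) \<noteq> 0}" for q
    by (rule finite_subset[OF _ finite_imageI[OF that, of f]])
      (auto simp: transport_def inv_f_f[OF f] split: if_splits)
  moreover have "finite {q. transport f x p q \<noteq> 0}" if "finite {j. x (inv f p) j \<noteq> 0}" for p
    by (rule finite_subset[OF _ finite_imageI[OF that, of f]])
      (auto simp: transport_def inv_f_f[OF f] split: if_splits)
  ultimately show ?thesis using L x by (auto simp: M_rcf_iff M_iff)
qed

lemma transport_rows_in: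
  fixes x :: "('i, 'r::zero) matrix"
  assumes f: "inj f" and L: "L = M \<or> L = M_rcf" and x: "x \<in> L"
  shows "transport_rows f x \<in> L"
proof -
  have "finite {p. transport_rows f x p q \<noteq> 0}" if "finite {i. x i q \<noteq> 0}" for q
    by (rule finite_subset[OF _ finite_imageI[OF that, of f]])
      (auto simp: transport_rows_def inv_f_f[OF f] split: if_splits)
  moreover have "finite {q. transport_rows f x p q \<noteq> 0}" if "finite {j. x (inv f p) j \<noteq> 0}" for p
    by (rule finite_subset[OF _ that]) (auto simp: transport_rows_def)
  ultimately show ?thesis using L x by (auto simp: M_rcf_iff M_iff)
qed

lemma pullback_matrix_in_M_rcf:
  assumes f: "inj f"
  shows "pullback_matrix f \<in> (M_rcf :: ('i, 'r::{ring,monoid_mult}) matrix set)"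
proof -
  have "finite {p. pullback_matrix f p q \<noteq> (0 :: 'r)}" for q
    by (rule finite_subset[of _ "{inv f q}"]) (auto simp: pullback_matrix_def inv_f_f[OF f])
  moreover have "finite {q. pullback_matrix f p q \<noteq> (0 :: 'r)}" for p
    by (rule finite_subset[of _ "{f p}"]) (auto simp: pullback_matrix_def)
  ultimately show ?thesis by (simp add: M_rcf_iff M_iff)
qed

text \<open>The matrix \<open>pullback_matrix f\<close> times its transpose is the identity, while
  the product in the other order only projects onto the range of \<open>f\<close>.\<close>

lemma bracket_pullback_transport_rows:
  fixes x :: "('i, 'r::{ring,monoid_mult}) matrix"
  assumes f: "inj f" and x: "x \<in> M"
  shows "bracket (pullback_matrix f) (transport_rows f x) = x - transport f x"
proof -
  have "transport_rows f x \<in> M" using transport_rows_in[OF f _ x] by blast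
  then have fin: "finite {k. transport_rows f x k q \<noteq> 0}" for q
    by (simp add: M_iff)
  have "(pullback_matrix f \<star> transport_rows f x) p q =
      pullback_matrix f p (f p) * transport_rows f x (f p) q" for p q
    by (rule mat_mult_eq_single[OF fin]) (simp add: pullback_matrix_def)
  then have 1: "(pullback_matrix f \<star> transport_rows f x) p q = x p q" for p q
    by (simp add: pullback_matrix_def transport_rows_def inv_f_f[OF f])
  have "pullback_matrix f \<in> (M :: ('i, 'r) matrix set)"
    using pullback_matrix_in_M_rcf[OF f, where 'r = 'r] by (simp add: M_rcf_iff)
  then have fin: "finite {k. pullback_matrix f k q \<noteq> (0 :: 'r)}" for q
    by (simp add: M_iff)
  have "(transport_rows f x \<star> pullback_matrix f) p q =
      transport_rows f x p (inv f q) * pullback_matrix f (inv f q) q" for p q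
    by (rule mat_mult_eq_single[OF fin]) (auto simp: pullback_matrix_def inv_f_f[OF f])
  then have 2: "(transport_rows f x \<star> pullback_matrix f) p q = transport f x p q" for p q
    by (auto simp: pullback_matrix_def transport_rows_def transport_def f_inv_into_f)
  show ?thesis by (intro ext) (simp add: bracket_def 1 2)
qed

text \<open>
  An Eilenberg swindle: identify the index set with its product with the natural numbers, and let
  \<open>y\<close> be the block diagonal matrix with infinitely many copies of \<open>x\<close>. Transporting along an
  injection does not change a matrix modulo commutators, and shifting the blocks of \<open>y\<close> by one
  removes the first copy of \<open>x\<close>.
\<close>

lemma additive_zero_if_zero_on_brackets:
  fixes z :: "('i, 'r::{ring,monoid_mult}) matrix \<Rightarrow> 'a::ab_group_add"
  assumes inf: "infinite (UNIV :: 'i set)" and L: "L = M \<or> L = M_rcf"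
    and add: "\<And>x y. x \<in> L \<Longrightarrow> y \<in> L \<Longrightarrow> z (x + y) = z x + z y"
    and bracket: "\<And>x y. x \<in> L \<Longrightarrow> y \<in> L \<Longrightarrow> z (bracket x y) = 0"
    and x: "x \<in> L"
  shows "z x = 0"
proof -
  have L_M: "y \<in> M" if "y \<in> L" for y using that L by (auto simp: M_rcf_iff)
  have L_diff: "y - w \<in> L" if "y \<in> L" "w \<in> L" for y w
    using that L by (auto intro: M_diff M_rcf_diff)
  have transport: "z (transport f y) = z y" if f: "inj f" and y: "y \<in> L" for f y
  proof -
    have t: "transport f y \<in> L" by (rule transport_in[OF f L y])
    have "pullback_matrix f \<in> L"
      using pullback_matrix_in_M_rcf[OF f, where 'r = 'r] L by (auto simp: M_rcf_iff)
    then have "z (y - transport f y) = 0"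
      using bracket transport_rows_in[OF f L y]
      by (simp flip: bracket_pullback_transport_rows[OF f L_M[OF y]])
    then show ?thesis
      using add[OF L_diff[OF y t] t] by simp
  qed
  \<comment> \<open>Cardinal arithmetic: an infinite set is equipotent to its product with the
    natural numbers.\<close>
  have "(card_of (UNIV :: nat set), card_of (UNIV :: 'i set)) \<in> ordLeq"
    using inf infinite_iff_card_of_nat by blast
  then have "(card_of ((UNIV :: 'i set) \<times> (UNIV :: nat set)), card_of (UNIV :: 'i set)) \<in> ordIso"
    using card_of_Times_infinite[OF inf] by blast
  then obtain h :: "'i \<times> nat \<Rightarrow> 'i" where "bij_betw h (UNIV \<times> UNIV) UNIV"
    using card_of_ordIso by blast
  then have h: "bij h" by simp
  have h_inj: "h a = h b \<longleftrightarrow> a = b" for a b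
    using h by (simp add: bij_is_inj inj_eq)
  have h_cases: "\<exists>i n. p = h (i, n)" for p
  proof (intro exI)
    show "p = h (fst (inv h p), snd (inv h p))"
      using h by (simp add: bij_is_surj surj_f_inv_f)
  qed
  \<comment> \<open>Under \<open>h\<close>, \<open>first\<close> embeds the index set as block 0 and
    \<open>shift\<close> moves block \<open>n\<close> to block \<open>n + 1\<close>; their ranges
    partition the index set.\<close>
  define first where "first i = h (i, 0)" for i
  define shift where "shift p = (case inv h p of (i, n) \<Rightarrow> h (i, Suc n))" for p
  have shift_h: "shift (h (i, n)) = h (i, Suc n)" for i n
    using h by (simp add: shift_def bij_is_inj)
  have first_inj: "inj first" by (auto simp: inj_def first_def h_inj)
  have shift_inj: "inj shift"
  proof (rule injI)
    fix p q assume "shift p = shift q"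
    moreover obtain i m where "p = h (i, m)" using h_cases by blast
    moreover obtain j n where "q = h (j, n)" using h_cases by blast
    ultimately show "p = q" by (simp add: shift_h h_inj)
  qed
  define y where "y p q =
    (if snd (inv h p) = snd (inv h q) then x (fst (inv h p)) (fst (inv h q)) else 0)" for p q
  have y_h: "y (h (i, m)) (h (j, n)) = (if m = n then x i j else 0)" for i j m n
    using h by (simp add: y_def bij_is_inj)
  have "finite {p. y p q \<noteq> 0}" if "\<And>j. finite {i. x i j \<noteq> 0}" for q
  proof -
    obtain j n where q: "q = h (j, n)" using h_cases by blast
    have "p \<in> (\<lambda>i. h (i, n)) ` {i. x i j \<noteq> 0}" if "y p q \<noteq> 0" for p
    proof -
      obtain i m where "p = h (i, m)" using h_cases by blast
      then show ?thesis using that by (auto simp: q y_h split: if_splits)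
    qed
    then have "{p. y p q \<noteq> 0} \<subseteq> (\<lambda>i. h (i, n)) ` {i. x i j \<noteq> 0}" by blast
    then show ?thesis by (rule finite_subset) (rule finite_imageI[OF that])
  qed
  moreover have "finite {q. y p q \<noteq> 0}" if "\<And>i. finite {j. x i j \<noteq> 0}" for p
  proof -
    obtain i m where p: "p = h (i, m)" using h_cases by blast
    have "q \<in> (\<lambda>j. h (j, m)) ` {j. x i j \<noteq> 0}" if "y p q \<noteq> 0" for q
    proof -
      obtain j n where "q = h (j, n)" using h_cases by blast
      then show ?thesis using that by (auto simp: p y_h split: if_splits)
    qed
    then have "{q. y p q \<noteq> 0} \<subseteq> (\<lambda>j. h (j, m)) ` {j. x i j \<noteq> 0}" by blast
    then show ?thesis by (rule finite_subset) (rule finite_imageI[OF that])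
  qed
  ultimately have y: "y \<in> L" using L x by (auto simp: M_rcf_iff M_iff)
  have range_first: "h (i, n) \<in> range first \<longleftrightarrow> n = 0" for i n
    by (auto simp: first_def h_inj)
  have range_shift: "h (i, n) \<in> range shift \<longleftrightarrow> n \<noteq> 0" for i n
  proof
    assume "h (i, n) \<in> range shift"
    then obtain p where "h (i, n) = shift p" by blast
    moreover obtain j m where "p = h (j, m)" using h_cases by blast
    ultimately show "n \<noteq> 0" by (simp add: shift_h h_inj)
  next
    assume "n \<noteq> 0"
    then have "h (i, n) = shift (h (i, n - 1))" by (simp add: shift_h)
    then show "h (i, n) \<in> range shift" by blast
  qed
  have inv_first: "inv first (h (i, 0)) = i" for i
    using inv_f_f[OF first_inj, of i] by (simp add: first_def)
  have inv_shift: "inv shift (h (i, Suc n)) = h (i, n)" for i n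
    using inv_f_f[OF shift_inj, of "h (i, n)"] by (simp add: shift_h)
  have "y = transport first x + transport shift y"
  proof (intro ext)
    fix p q
    obtain i m where p: "p = h (i, m)" using h_cases by blast
    obtain j n where q: "q = h (j, n)" using h_cases by blast
    show "y p q = (transport first x + transport shift y) p q"
      by (cases m; cases n)
        (simp_all add: p q y_h transport_def range_first range_shift inv_first inv_shift)
  qed
  \<comment> \<open>Transport preserves \<open>z\<close>, so this reads
    \<open>z y = z x + z y\<close>, and \<open>z y\<close> cancels.\<close>
  then have "z y = z (transport first x) + z (transport shift y)"
    using add[OF transport_in[OF first_inj L x] transport_in[OF shift_inj L y]] by simp
  then show ?thesis
    by (simp add: transport[OF first_inj x] transport[OF shift_inj y])
qed

text \<open>Double brackets with suitable units fall into \<open>sl_inf\<close>, where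
  \<open>d\<close> vanishes. This forces the values of \<open>d\<close> to be central scalars, so
  \<open>d\<close> kills all brackets and the swindle applies.\<close>

lemma derivation_zero_if_zero_on_sl_inf:
  fixes d :: "('i, 'r::{ring,monoid_mult}) matrix \<Rightarrow> ('i, 'r) matrix"
  assumes d: "derivation_into L d" and inf: "infinite (UNIV :: 'i set)"
    and L: "L = M \<or> L = M_rcf"
    and zero: "\<And>x. x \<in> sl_inf \<Longrightarrow> d x = 0"
    and x: "x \<in> L"
  shows "d x = 0"
proof -
  have L_M: "y \<in> M" if "y \<in> L" for y using that L by (auto simp: M_rcf_iff)
  have L_bracket: "bracket y w \<in> L" if "y \<in> L" "w \<in> L" for y w
    using that L by (auto intro: M_bracket M_rcf_bracket)
  have unit_L: "mat_unit i j r \<in> L" for i j and r :: 'r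
    using L mat_unit_in_M mat_unit_in_M_rcf by auto
  have scalar: "bracket (d y) w = 0 \<and> bracket w (d y) = 0" if y: "y \<in> L" and w: "w \<in> M" for y w
  proof -
    have "bracket (bracket (d y) (mat_unit i j r)) (mat_unit j l 1) = 0"
      if ijl: "i \<noteq> j" "j \<noteq> l" "i \<noteq> l" for i j l r
    proof -
      have units: "d (mat_unit i j r) = 0" "d (mat_unit j l 1) = 0"
        using ijl by (simp_all add: zero mat_unit_in_sl_inf)
      have "d (bracket (bracket y (mat_unit i j r)) (mat_unit j l 1)) = 0"
        by (rule zero) (rule double_bracket_units_in_sl_inf[OF L_M[OF y] ijl])
      \<comment> \<open>In the Leibniz expansion the terms containing \<open>d\<close> of a unit
        vanish, leaving the double bracket of \<open>d y\<close>.\<close>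
      then show ?thesis
        by (simp add: derivation_into_bracket[OF d] y unit_L L_bracket units)
    qed
    from central_scalar_if_double_brackets_zero[OF derivation_into_mem[OF d y] inf this]
    obtain c where "d y = (\<lambda>p q. if p = q then c else 0)" "\<And>r. c * r = r * c"
      by blast
    then show ?thesis using bracket_central_scalar[OF w, of c] by (simp only:)
  qed
  show ?thesis
  proof (rule additive_zero_if_zero_on_brackets[OF inf L _ _ x])
    fix y w assume yw: "y \<in> L" "w \<in> L"
    show "d (y + w) = d y + d w" by (rule derivation_into_add[OF d yw])
    show "d (bracket y w) = 0"
      using derivation_into_bracket[OF d yw] scalar yw L_M by simp
  qed
qed

theorem derivation_on_gl:
  fixes d :: "('i, 'r::{ring,monoid_mult}) matrix \<Rightarrow> ('i, 'r) matrix"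
  assumes d: "lie_derivation L d" and L: "L = M \<or> L = M_rcf"
    and inf: "infinite (UNIV :: 'i set)"
    and half: "\<exists>h::'r. (1 + 1) * h = 1 \<and> h * (1 + 1) = 1"
  shows "\<exists>a\<in>L. \<exists>u\<in>Der. \<forall>x\<in>L. d x = ad a x + entrywise u x"
proof -
  have L_M: "L \<subseteq> M" using L by (auto simp: M_rcf_iff)
  have sl: "sl_inf \<subseteq> L"
    using L L_M sl_inf_subset_M_rcf[OF inf, where 'r = 'r] by (auto simp: M_rcf_iff)
  have dL: "derivation_into L d"
    using d L_M by (rule lie_derivation_imp_derivation_into)
  obtain a u where a: "a \<in> M" "\<forall>x\<in>sl_inf. d x \<in> M_rcf \<Longrightarrow> a \<in> M_rcf" and u: "u \<in> Der"
    and eq: "\<And>x. x \<in> sl_inf \<Longrightarrow> d x = ad a x + entrywise u x"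
    using derivation_on_sl_inf[OF derivation_into_subset[OF dL sl] inf half] by blast
  \<comment> \<open>For \<open>L = M_rcf\<close>, the map \<open>d\<close> sends
    \<open>sl_inf\<close> into \<open>M_rcf\<close>, which is the condition for \<open>a\<close> to
    be row-finite.\<close>
  have "a \<in> L"
    using L a sl d by (auto simp: lie_derivation_def)
  moreover have "d x = ad a x + entrywise u x" if "x \<in> L" for x
  proof -
    have "derivation_into L (\<lambda>x. d x - ad a x - entrywise u x)"
      by (intro derivation_into_minus dL derivation_into_ad derivation_into_entrywise a u L_M)
    then have "d x - ad a x - entrywise u x = 0"
      using inf L _ that by (rule derivation_zero_if_zero_on_sl_inf) (simp add: eq)
    then show ?thesis by (simp add: algebra_simps)
  qed
  ultimately show ?thesis using u by blast
qed

theorem theorem2: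
  assumes half: "\<exists>h::'r::{ring,monoid_mult}. (1 + 1) * h = 1 \<and> h * (1 + 1) = 1"
    and inf: "infinite (UNIV :: 'i set)"
  shows
    "(\<forall>d. lie_derivation (sl_inf :: ('i, 'r) matrix set) d \<longrightarrow>
        (\<exists>a\<in>gl_rcf. \<exists>u\<in>Der. \<forall>x\<in>sl_inf. d x = ad a x + entrywise u x)) \<and>
     (\<forall>d. lie_derivation (gl :: ('i, 'r) matrix set) d \<longrightarrow>
        (\<exists>a\<in>gl. \<exists>u\<in>Der. \<forall>x\<in>gl. d x = ad a x + entrywise u x)) \<and>
     (\<forall>d. lie_derivation (gl_rcf :: ('i, 'r) matrix set) d \<longrightarrow>
        (\<exists>a\<in>gl_rcf. \<exists>u\<in>Der. \<forall>x\<in>gl_rcf. d x = ad a x + entrywise u x))"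
proof (intro conjI allI impI)
  fix d :: "('i, 'r) matrix \<Rightarrow> ('i, 'r) matrix"
  assume d: "lie_derivation sl_inf d"
  have sl: "sl_inf \<subseteq> (M_rcf :: ('i, 'r) matrix set)"
    by (rule sl_inf_subset_M_rcf[OF inf])
  have "derivation_into sl_inf d"
    by (rule lie_derivation_imp_derivation_into[OF d]) (use sl in \<open>auto simp: M_rcf_iff\<close>)
  moreover have "\<forall>x\<in>sl_inf. d x \<in> M_rcf"
    using d sl by (auto simp: lie_derivation_def)
  ultimately show "\<exists>a\<in>gl_rcf. \<exists>u\<in>Der. \<forall>x\<in>sl_inf. d x = ad a x + entrywise u x"
    by (elim derivation_on_sl_inf[OF _ inf half]) blast
next
  fix d :: "('i, 'r) matrix \<Rightarrow> ('i, 'r) matrix"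
  assume "lie_derivation gl d"
  then show "\<exists>a\<in>gl. \<exists>u\<in>Der. \<forall>x\<in>gl. d x = ad a x + entrywise u x"
    by (rule derivation_on_gl[OF _ _ inf half]) simp
next
  fix d :: "('i, 'r) matrix \<Rightarrow> ('i, 'r) matrix"
  assume "lie_derivation gl_rcf d"
  then show "\<exists>a\<in>gl_rcf. \<exists>u\<in>Der. \<forall>x\<in>gl_rcf. d x = ad a x + entrywise u x"
    by (rule derivation_on_gl[OF _ _ inf half]) simp
qed

end
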